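(* Let $k\ge2$. For every instance of the MHV problem with $k$ colors, the linear programming relaxation (LP-MHV) is the same as the Lovász-extension relaxation (CP-Sup-ML) of the associated Sup-ML instance with set function $g(X)=w(\iota(X))$. That is, the two programs have the same feasible assignments $(y_j^i)_{v_j\in V,\,i\in C}$, and for every such assignment, with $z_j^i,z_j$ the values determined by the constraints of (LP-MHV), $$\sum_{j=1}^n w_j z_j=\sum_{i=1}^k\hat g(\mathbf{y}_i),\qquad \mathbf{y}_i=(y_1^i,\dots,y_n^i).$$
   Context: **MHV instance.** A finite undirected graph $G=(V,E)$, $V=\{v_1,\dots,v_n\}$, non-negative vertex weights $w_j=w(v_j)$, a color set $C=\{1,\dots,k\}$, and a partial vertex coloring $c$ with colors in $C$ in which every color is used on at least one vertex. The goal in the MHV problem is to extend $c$ to all vertices maximizing the total weight of happy vertices (vertices having the same color as all their neighbors). **(LP-MHV).** Maximize $\sum_{j=1}^n w_jz_j$ subject to: $\sum_{i=1}^k y_j^i=1$ for all $v_j\in V$; $y_j^i=1$ whenever $c(v_j)=i$; $z_j^i=\min_{v_h\in N[v_j]}y_h^i$ for all $v_j\in V$, $i\in C$; $z_j=\sum_{i=1}^k z_j^i$ for all $v_j\in V$; and $z_j,z_j^i,y_j^i\ge0$. Here $N[v_j]$ is the closed neighborhood of $v_j$. **Set function.** For $X\subseteq V$, $\partial(X)$ is the set of vertices of $X$ with at least one neighbor outside $X$, $\iota(X)=X\setminus\partial(X)$, $w(X)=\sum_{v\in X}w(v)$, $g(X)=w(\iota(X))$. **Lovász extension.** For $\mathbf{y}\in[0,1]^V$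 with maximum coordinate $1$ and minimum coordinate $0$, let $\pi$ be a permutation with $1=y_{\pi_1}\ge\dots\ge y_{\pi_n}=0$ and set $\hat g(\mathbf{y})=\sum_{j=1}^{n-1}(y_{\pi_j}-y_{\pi_{j+1}})\,g(\{v_{\pi_1},\dots,v_{\pi_j}\})$. **(CP-Sup-ML)** for this instance. Maximize $\sum_{i=1}^k\hat g(\mathbf{y}_i)$ subject to $\sum_{i=1}^k y_j^i=1$ for all $v_j\in V$; $y_j^i=1$ whenever $c(v_j)=i$; $y_j^i\ge0$ for all $v_j\in V$, $i\in C$. *)

theory Defs
  imports Complex_Main
begin

(* The colors are {1..k}; the partial coloring is a map, with None for uncolored vertices.
   An edge is a set {u, v} of vertices; loops (u = v) are permitted. *)

locale mhv_instance =
  fixes V :: "'a set" and E :: "'a set set" and w :: "'a \<Rightarrow> real"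
    and k :: nat and c :: "'a \<Rightarrow> nat option"
  assumes finite_V: "finite V"
    and edges: "\<And>e. e \<in> E \<Longrightarrow> \<exists>u\<in>V. \<exists>v\<in>V. e = {u, v}"
    and weight_nonneg: "\<And>v. v \<in> V \<Longrightarrow> w v \<ge> 0"
    and dom_coloring: "dom c \<subseteq> V"
    and colors_used: "ran c = {1..k}"

definition closed_nbhd :: "'a set set \<Rightarrow> 'a \<Rightarrow> 'a set" where
  "closed_nbhd E v = insert v {u. {v, u} \<in> E}"

definition boundary :: "'a set set \<Rightarrow> 'a set \<Rightarrow> 'a set" where
  "boundary E X = {v \<in> X. \<exists>u. {v, u} \<in> E \<and> u \<notin> X}"

definition inner_vertices :: "'a set set \<Rightarrow> 'a set \<Rightarrow> 'a set" where
  "inner_vertices E X = X - boundary E X"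

definition inner_weight :: "'a set set \<Rightarrow> ('a \<Rightarrow> real) \<Rightarrow> 'a set \<Rightarrow> real" where
  "inner_weight E w X = (\<Sum>v\<in>inner_vertices E X. w v)"

(* In both programs the variable y_j^i is y v i for the vertex v = v_j and the color i;
   only its values for v in V and i in {1..k} are constrained or used. *)

definition lp_mhv_feasible ::
  "'a set \<Rightarrow> 'a set set \<Rightarrow> nat \<Rightarrow> ('a \<Rightarrow> nat option) \<Rightarrow>
   ('a \<Rightarrow> nat \<Rightarrow> real) \<Rightarrow> ('a \<Rightarrow> nat \<Rightarrow> real) \<Rightarrow> ('a \<Rightarrow> real) \<Rightarrow> bool" where
  "lp_mhv_feasible V E k c y zc z \<longleftrightarrow>
     (\<forall>v\<in>V. (\<Sum>i=1..k. y v i) = 1) \<and>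
     (\<forall>v\<in>V. \<forall>i\<in>{1..k}. c v = Some i \<longrightarrow> y v i = 1) \<and>
     (\<forall>v\<in>V. \<forall>i\<in>{1..k}. zc v i = (MIN u\<in>closed_nbhd E v. y u i)) \<and>
     (\<forall>v\<in>V. z v = (\<Sum>i=1..k. zc v i)) \<and>
     (\<forall>v\<in>V. z v \<ge> 0) \<and>
     (\<forall>v\<in>V. \<forall>i\<in>{1..k}. zc v i \<ge> 0 \<and> y v i \<ge> 0)"

definition lp_mhv_objective :: "'a set \<Rightarrow> ('a \<Rightarrow> real) \<Rightarrow> ('a \<Rightarrow> real) \<Rightarrow> real" where
  "lp_mhv_objective V w z = (\<Sum>v\<in>V. w v * z v)"

definition lovasz_order :: "'a set \<Rightarrow> ('a \<Rightarrow> real) \<Rightarrow> (nat \<Rightarrow> 'a) \<Rightarrow> bool" where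
  "lovasz_order V x p \<longleftrightarrow>
     bij_betw p {1..card V} V \<and>
     x (p 1) = 1 \<and> x (p (card V)) = 0 \<and>
     (\<forall>j\<in>{1..<card V}. x (p j) \<ge> x (p (j + 1)))"

definition lovasz_sum :: "'a set \<Rightarrow> ('a set \<Rightarrow> real) \<Rightarrow> ('a \<Rightarrow> real) \<Rightarrow> (nat \<Rightarrow> 'a) \<Rightarrow> real" where
  "lovasz_sum V g x p = (\<Sum>j\<in>{1..<card V}. (x (p j) - x (p (j + 1))) * g (p ` {1..j}))"

(* The sum does not depend on how ties are broken, so it is the unique such value whenever x has
   maximum 1 and minimum 0 on V.  For other x there is no order and the value is unspecified. *)

definition lovasz_ext :: "'a set \<Rightarrow> ('a set \<Rightarrow> real) \<Rightarrow> ('a \<Rightarrow> real) \<Rightarrow> real" where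
  "lovasz_ext V g x = (THE r. \<exists>p. lovasz_order V x p \<and> r = lovasz_sum V g x p)"

definition cp_sup_ml_feasible ::
  "'a set \<Rightarrow> nat \<Rightarrow> ('a \<Rightarrow> nat option) \<Rightarrow> ('a \<Rightarrow> nat \<Rightarrow> real) \<Rightarrow> bool" where
  "cp_sup_ml_feasible V k c y \<longleftrightarrow>
     (\<forall>v\<in>V. (\<Sum>i=1..k. y v i) = 1) \<and>
     (\<forall>v\<in>V. \<forall>i\<in>{1..k}. c v = Some i \<longrightarrow> y v i = 1) \<and>
     (\<forall>v\<in>V. \<forall>i\<in>{1..k}. y v i \<ge> 0)"

definition cp_sup_ml_objective ::
  "'a set \<Rightarrow> ('a set \<Rightarrow> real) \<Rightarrow> nat \<Rightarrow> ('a \<Rightarrow> nat \<Rightarrow> real) \<Rightarrow> real" where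
  "cp_sup_ml_objective V g k y = (\<Sum>i=1..k. lovasz_ext V g (\<lambda>v. y v i))"

end

theory Submission imports Defs begin

text \<open>
  The vertices with closed neighborhood inside \<open>X\<close> are exactly the inner vertices of \<open>X\<close>. So in the
  Lovasz sum along an order \<open>p\<close>, the vertex \<open>v\<close> contributes its weight times the telescoping sum of
  the differences \<open>x (p j) - x (p (j + 1))\<close> over all \<open>j\<close> from the last index \<open>m\<close> of a vertex of
  \<open>N[v]\<close> on. That sum is \<open>x (p m)\<close>, the minimum of \<open>x\<close> over \<open>N[v]\<close>. Hence the Lovasz extension is
  the weighted sum of these minima, whatever the order.
\<close>

section \<open>Lovasz sums along a fixed order\<close>

lemma lovasz_order_antimono:
  assumes "lovasz_order V x p" "1 \<le> i" "i \<le> j" "j \<le> card V"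
  shows "x (p j) \<le> x (p i)"
  using assms(3,4)
proof (induction j rule: dec_induct)
  case (step j)
  then have "x (p (j + 1)) \<le> x (p j)"
    using assms(1,2) unfolding lovasz_order_def by auto
  with step show ?case by simp
qed simp

lemma lovasz_order_telescope:
  fixes x :: "'a \<Rightarrow> real"
  assumes ord: "lovasz_order V x p" and "N \<subseteq> V" "N \<noteq> {}"
  shows "(\<Sum>j\<in>{1..<card V}. (x (p j) - x (p (j + 1))) * of_bool (N \<subseteq> p ` {1..j})) = Min (x ` N)"
proof -
  define n where "n = card V"
  \<comment> \<open>\<open>J\<close> holds the positions of the members of \<open>N\<close>. A
    prefix of the order contains \<open>N\<close> exactly when it reaches the last of them,
    \<open>m\<close>.\<close>
  define J where "J = {j\<in>{1..n}. p j \<in> N}"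
  define m where "m = Max J"
  have bij: "bij_betw p {1..n} V" and last: "x (p n) = 0"
    using ord by (auto simp: lovasz_order_def n_def)
  have N_eq: "N = p ` J"
    using bij_betw_imp_surj_on[OF bij] \<open>N \<subseteq> V\<close> by (auto simp: J_def)
  have "finite J" "J \<noteq> {}"
    using N_eq \<open>N \<noteq> {}\<close> by (auto simp: J_def)
  then have m: "m \<in> J" "\<And>j. j \<in> J \<Longrightarrow> j \<le> m"
    by (auto simp: m_def)
  then have m_range: "1 \<le> m" "m \<le> n"
    by (auto simp: J_def)
  have sub_iff: "N \<subseteq> p ` {1..j} \<longleftrightarrow> m \<le> j" if "j \<in> {1..<n}" for j
  proof
    assume "N \<subseteq> p ` {1..j}"
    then obtain i where i: "i \<in> {1..j}" "p m = p i"
      using m(1) by (auto simp: J_def)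
    then have "m = i"
      using inj_onD[OF bij_betw_imp_inj_on[OF bij]] m_range that by auto
    with i show "m \<le> j" by simp
  next
    assume "m \<le> j"
    then show "N \<subseteq> p ` {1..j}"
      using m(2) unfolding N_eq by (force simp: J_def)
  qed
  have "(\<Sum>j\<in>{1..<n}. (x (p j) - x (p (j + 1))) * of_bool (N \<subseteq> p ` {1..j}))
      = (\<Sum>j\<in>{1..<n}. (x (p j) - x (p (j + 1))) * of_bool (m \<le> j))"
    by (simp only: sub_iff cong: sum.cong)
  also have "\<dots> = (\<Sum>j\<in>{m..<n}. x (p j) - x (p (j + 1)))"
    using m_range by (intro sum.mono_neutral_cong_right) auto
  also have "\<dots> = - (\<Sum>j\<in>{m..<n}. x (p (Suc j)) - x (p j))"
    unfolding sum_negf[symmetric] by simp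
  \<comment> \<open>The telescoping leaves \<open>x (p m) - x (p n)\<close>, and
    \<open>x (p n) = 0\<close>. If \<open>m = n\<close>, the sum is empty and \<open>x (p m)\<close>
    is 0 as well.\<close>
  also have "\<dots> = x (p m)"
    using m_range(2) last by (simp add: sum_Suc_diff'[where f = "\<lambda>j. x (p j)"])
  also have "\<dots> = Min (x ` N)"
  proof (rule Min_eqI[symmetric])
    show "finite (x ` N)"
      using \<open>finite J\<close> N_eq by simp
    show "x (p m) \<in> x ` N"
      using m(1) N_eq by blast
    show "x (p m) \<le> r" if "r \<in> x ` N" for r
    proof -
      from that obtain j where "j \<in> J" "r = x (p j)"
        using N_eq by auto
      then show ?thesis
        using lovasz_order_antimono[OF ord, of j m] m(2)[of j] m_range by (simp add: J_def n_def)
    qed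
  qed
  finally show ?thesis by (simp add: n_def)
qed

lemma inner_vertices_eq: "inner_vertices E X = {v. closed_nbhd E v \<subseteq> X}"
  by (auto simp: inner_vertices_def boundary_def closed_nbhd_def)

text \<open>With indicators the index set \<open>V\<close> no longer depends on \<open>X\<close>, so
  in the Lovasz sum the summations over prefixes and over vertices can be exchanged.\<close>

lemma inner_weight_eq_sum_of_bool:
  assumes "finite V" "X \<subseteq> V"
  shows "inner_weight E w X = (\<Sum>v\<in>V. w v * of_bool (closed_nbhd E v \<subseteq> X))"
proof -
  have "inner_vertices E X \<subseteq> V"
    using assms(2) by (auto simp: inner_vertices_def)
  then show ?thesis
    using assms(1) unfolding inner_weight_def
    by (intro sum.mono_neutral_cong_left) (auto simp: inner_vertices_eq)
qed

lemma lovasz_sum_inner_weight: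
  assumes ord: "lovasz_order V x p" and "finite V"
    and nbhd: "\<And>v. v \<in> V \<Longrightarrow> closed_nbhd E v \<subseteq> V"
  shows "lovasz_sum V (inner_weight E w) x p = (\<Sum>v\<in>V. w v * (MIN u\<in>closed_nbhd E v. x u))"
proof -
  let ?d = "\<lambda>j. x (p j) - x (p (j + 1))"
  let ?b = "\<lambda>v j. of_bool (closed_nbhd E v \<subseteq> p ` {1..j}) :: real"
  have "p ` {1..card V} = V"
    using ord by (auto simp: lovasz_order_def bij_betw_def)
  then have prefix: "p ` {1..j} \<subseteq> V" if "j \<in> {1..<card V}" for j
    using that by force
  have "lovasz_sum V (inner_weight E w) x p = (\<Sum>j\<in>{1..<card V}. \<Sum>v\<in>V. ?d j * (w v * ?b v j))"
    unfolding lovasz_sum_def sum_distrib_left[symmetric]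
    by (intro sum.cong refl arg_cong2[of _ _ _ _ "(*)"]
        inner_weight_eq_sum_of_bool[OF \<open>finite V\<close> prefix])
  \<comment> \<open>After the exchange each vertex carries its own telescoping sum.\<close>
  also have "\<dots> = (\<Sum>v\<in>V. w v * (\<Sum>j\<in>{1..<card V}. ?d j * ?b v j))"
    by (subst sum.swap) (simp only: sum_distrib_left mult.left_commute)
  also have "\<dots> = (\<Sum>v\<in>V. w v * (MIN u\<in>closed_nbhd E v. x u))"
  proof (intro sum.cong refl arg_cong2[of _ _ _ _ "(*)"] lovasz_order_telescope[OF ord])
    show "closed_nbhd E v \<subseteq> V" if "v \<in> V" for v
      using nbhd that .
    show "closed_nbhd E v \<noteq> {}" for v
      by (simp add: closed_nbhd_def)
  qed
  finally show ?thesis .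
qed

section \<open>Existence of orders and the value of the Lovasz extension\<close>

lemma lovasz_order_exists:
  fixes x :: "'a \<Rightarrow> real"
  assumes "finite V" and range: "\<And>v. v \<in> V \<Longrightarrow> 0 \<le> x v \<and> x v \<le> 1"
    and "a \<in> V" "x a = 1" "b \<in> V" "x b = 0"
  shows "\<exists>p. lovasz_order V x p"
proof -
  obtain ys where ys: "set ys = V" "distinct ys"
    using finite_distinct_list[OF \<open>finite V\<close>] by blast
  \<comment> \<open>Sorting is ascending, so the negated key lists the vertices by decreasing
    \<open>x\<close>.\<close>
  define xs where "xs = sort_key (\<lambda>v. - x v) ys"
  have xs: "set xs = V" "length xs = card V" "distinct xs"
    using ys by (auto simp: xs_def distinct_card)
  have "sorted (map (\<lambda>v. - x v) xs)"
    by (simp add: xs_def)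
  then have anti: "x (xs ! j) \<le> x (xs ! i)" if "i \<le> j" "j < card V" for i j
    using that sorted_nth_mono[of "map (\<lambda>v. - x v) xs" i j] by (simp add: xs(2))
  \<comment> \<open>Lists are indexed from 0 and orders from 1, hence the shift.\<close>
  have "bij_betw (\<lambda>j. j - 1) {1..card V} {..<card V}"
    by (rule bij_betw_byWitness[where f' = Suc]) auto
  moreover have "bij_betw ((!) xs) {..<card V} V"
    by (rule bij_betw_nth) (simp_all add: xs)
  ultimately have bij: "bij_betw (\<lambda>j. xs ! (j - 1)) {1..card V} V"
    using bij_betw_trans unfolding comp_def by blast
  obtain i j where ij: "i < card V" "xs ! i = a" "j < card V" "xs ! j = b"
    using assms(3,5) xs by (metis in_set_conv_nth)
  \<comment> \<open>The head is at least \<open>x a = 1\<close> by sorting and at most 1 by the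
    bounds; the last entry is treated dually with \<open>b\<close>.\<close>
  have first: "x (xs ! 0) = 1"
  proof (rule antisym)
    show "x (xs ! 0) \<le> 1"
      using range nth_mem[of 0 xs] ij xs by fastforce
    show "1 \<le> x (xs ! 0)"
      using anti[of 0 i] ij assms(4) by simp
  qed
  have last: "x (xs ! (card V - 1)) = 0"
  proof (rule antisym)
    show "x (xs ! (card V - 1)) \<le> 0"
      using anti[of j "card V - 1"] ij assms(6) by simp
    show "0 \<le> x (xs ! (card V - 1))"
      using range nth_mem[of "card V - 1" xs] ij xs by simp
  qed
  have "lovasz_order V x (\<lambda>j. xs ! (j - 1))"
    unfolding lovasz_order_def using bij first last anti by auto
  then show ?thesis by blast
qed

text \<open>Every order gives this same value, which is the uniqueness that the definite description
  requires; \<open>p\<close> supplies the existence.\<close>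

lemma lovasz_ext_inner_weight:
  assumes "finite V" "\<And>v. v \<in> V \<Longrightarrow> closed_nbhd E v \<subseteq> V"
    and "lovasz_order V x p"
  shows "lovasz_ext V (inner_weight E w) x = (\<Sum>v\<in>V. w v * (MIN u\<in>closed_nbhd E v. x u))"
  unfolding lovasz_ext_def
  by (rule the_equality) (use assms lovasz_sum_inner_weight[of V x _ E w] in auto)

section \<open>Comparison of the two programs\<close>

context mhv_instance
begin

lemma closed_nbhd_subset: "v \<in> V \<Longrightarrow> closed_nbhd E v \<subseteq> V"
  using edges by (fastforce simp: closed_nbhd_def doubleton_eq_iff)

lemma cp_sup_ml_feasible_le_1:
  assumes "cp_sup_ml_feasible V k c y" "v \<in> V" "i \<in> {1..k}"
  shows "y v i \<le> 1"
  using assms member_le_sum[of i "{1..k}" "y v"] by (auto simp: cp_sup_ml_feasible_def)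

text \<open>The minimum 0 of the coordinate of color \<open>i\<close> is attained at a vertex precolored with a
  different color; this is where \<open>k \<ge> 2\<close> is needed.\<close>

lemma cp_sup_ml_feasible_lovasz_order:
  assumes "k \<ge> 2" and feas: "cp_sup_ml_feasible V k c y" and i: "i \<in> {1..k}"
  shows "\<exists>p. lovasz_order V (\<lambda>v. y v i) p"
proof -
  have colored: "\<exists>v\<in>V. y v i' = 1" if "i' \<in> {1..k}" for i'
  proof -
    from that obtain v where "c v = Some i'"
      using colors_used by (auto simp: ran_def set_eq_iff)
    with that feas dom_coloring show ?thesis
      unfolding cp_sup_ml_feasible_def by (metis domI subsetD)
  qed
  obtain a where a: "a \<in> V" "y a i = 1"
    using colored[OF i] by blast
  \<comment> \<open>A color other than \<open>i\<close>; both 1 and 2 are colors because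
    \<open>k \<ge> 2\<close>.\<close>
  define i' where "i' = (if i = 1 then 2 else 1 :: nat)"
  have i': "i' \<in> {1..k}" "i' \<noteq> i"
    using \<open>k \<ge> 2\<close> by (auto simp: i'_def)
  obtain b where b: "b \<in> V" "y b i' = 1"
    using colored[OF i'(1)] by blast
  have nonneg: "0 \<le> y v j" if "v \<in> V" "j \<in> {1..k}" for v j
    using feas that by (simp add: cp_sup_ml_feasible_def)
  \<comment> \<open>Color \<open>i'\<close> already takes the whole unit of mass at
    \<open>b\<close>, which leaves 0 for color \<open>i\<close>.\<close>
  have "sum (y b) {i, i'} \<le> sum (y b) {1..k}"
    using i i' nonneg[OF b(1)] by (intro sum_mono2) auto
  also have "\<dots> = 1"
    using feas b(1) by (simp add: cp_sup_ml_feasible_def)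
  finally have "y b i = 0"
    using i i'(2) b nonneg[OF b(1) i] by simp
  with a b(1) show ?thesis
    using finite_V nonneg i cp_sup_ml_feasible_le_1[OF feas] by (intro lovasz_order_exists) auto
qed

lemma cp_sup_ml_objective_eq:
  assumes "k \<ge> 2" "cp_sup_ml_feasible V k c y"
  shows "cp_sup_ml_objective V (inner_weight E w) k y =
    (\<Sum>v\<in>V. w v * (\<Sum>i=1..k. MIN u\<in>closed_nbhd E v. y u i))"
proof -
  have "lovasz_ext V (inner_weight E w) (\<lambda>v. y v i) =
      (\<Sum>v\<in>V. w v * (MIN u\<in>closed_nbhd E v. y u i))" if "i \<in> {1..k}" for i
    using cp_sup_ml_feasible_lovasz_order[OF assms that]
      lovasz_ext_inner_weight[OF finite_V closed_nbhd_subset] by blast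
  then have "cp_sup_ml_objective V (inner_weight E w) k y =
      (\<Sum>i=1..k. \<Sum>v\<in>V. w v * (MIN u\<in>closed_nbhd E v. y u i))"
    by (simp add: cp_sup_ml_objective_def)
  also have "\<dots> = (\<Sum>v\<in>V. w v * (\<Sum>i=1..k. MIN u\<in>closed_nbhd E v. y u i))"
    by (subst sum.swap) (simp add: sum_distrib_left)
  finally show ?thesis .
qed

text \<open>The variables \<open>zc\<close> and \<open>z\<close> are determined by \<open>y\<close>,
  so only their nonnegativity has to be checked: each \<open>zc v i\<close> is a minimum of
  nonnegative values over a finite nonempty set.\<close>

lemma lp_mhv_feasible_exists_iff:
  "(\<exists>zc z. lp_mhv_feasible V E k c y zc z) \<longleftrightarrow> cp_sup_ml_feasible V k c y"
proof
  assume "\<exists>zc z. lp_mhv_feasible V E k c y zc z"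
  then show "cp_sup_ml_feasible V k c y"
    by (auto simp: lp_mhv_feasible_def cp_sup_ml_feasible_def)
next
  assume feas: "cp_sup_ml_feasible V k c y"
  define zc where "zc v i = (MIN u\<in>closed_nbhd E v. y u i)" for v i
  have zc_nonneg: "0 \<le> zc v i" if "v \<in> V" "i \<in> {1..k}" for v i
  proof -
    have sub: "closed_nbhd E v \<subseteq> V"
      using closed_nbhd_subset that(1) .
    have ne: "closed_nbhd E v \<noteq> {}"
      by (simp add: closed_nbhd_def)
    have "0 \<le> y u i" if "u \<in> closed_nbhd E v" for u
      using feas sub that \<open>i \<in> {1..k}\<close> by (auto simp: cp_sup_ml_feasible_def)
    then show ?thesis
      using finite_subset[OF sub finite_V] ne by (simp add: zc_def)
  qed
  have "lp_mhv_feasible V E k c y zc (\<lambda>v. \<Sum>i=1..k. zc v i)"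
    using feas zc_nonneg
    by (auto simp: lp_mhv_feasible_def cp_sup_ml_feasible_def zc_def intro!: sum_nonneg)
  then show "\<exists>zc z. lp_mhv_feasible V E k c y zc z" by blast
qed

text \<open>The right-hand side is that of \<open>cp_sup_ml_objective_eq\<close>, so the two
  objectives meet in this common form.\<close>

lemma lp_mhv_objective_eq:
  assumes "lp_mhv_feasible V E k c y zc z"
  shows "lp_mhv_objective V w z = (\<Sum>v\<in>V. w v * (\<Sum>i=1..k. MIN u\<in>closed_nbhd E v. y u i))"
  using assms by (simp add: lp_mhv_objective_def lp_mhv_feasible_def)

end

theorem theorem5:
  fixes V :: "'a set" and E :: "'a set set" and w :: "'a \<Rightarrow> real"
    and k :: nat and c :: "'a \<Rightarrow> nat option"
  assumes "k \<ge> 2"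
    and "mhv_instance V E w k c"
  shows "{y. \<exists>zc z. lp_mhv_feasible V E k c y zc z} = {y. cp_sup_ml_feasible V k c y} \<and>
         (\<forall>y zc z. lp_mhv_feasible V E k c y zc z \<longrightarrow>
            lp_mhv_objective V w z = cp_sup_ml_objective V (inner_weight E w) k y)"
proof -
  interpret mhv_instance V E w k c by fact
  show ?thesis
  proof (intro conjI allI impI)
    show "{y. \<exists>zc z. lp_mhv_feasible V E k c y zc z} = {y. cp_sup_ml_feasible V k c y}"
      by (simp only: lp_mhv_feasible_exists_iff)
    fix y zc z
    assume lp: "lp_mhv_feasible V E k c y zc z"
    then have "cp_sup_ml_feasible V k c y"
      using lp_mhv_feasible_exists_iff by blast
    then show "lp_mhv_objective V w z = cp_sup_ml_objective V (inner_weight E w) k y"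
      using cp_sup_ml_objective_eq[OF \<open>k \<ge> 2\<close>] lp_mhv_objective_eq[OF lp] by simp
  qed
qed

end
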